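(* Let $\mathcal{X}\in\mathbb{C}^{I_1\times I_2\times\cdots\times I_N}$ be an $N$-way tensor with an independent Tucker decomposition $\mathcal{X}=[\![\mathcal{G};\mathbf{X}^{(1)},\ldots,\mathbf{X}^{(N)}]\!]$, where $\mathcal{G}\in\mathbb{C}^{J_1\times\cdots\times J_N}$ and $\mathbf{X}^{(n)}\in\mathbb{C}^{I_n\times J_n}$ for $n=1,\ldots,N$. Then $\mathrm{rank}_{CP}(\mathcal{X})=\mathrm{rank}_{CP}(\mathcal{G})$.
   Context: Mode-$n$ product: for $\mathcal{X}\in\mathbb{C}^{I_1\times\cdots\times I_N}$ and a matrix $\mathbf{A}\in\mathbb{C}^{J\times I_n}$, $\mathcal{X}\times_n\mathbf{A}$ is the tensor of size $I_1\times\cdots\times I_{n-1}\times J\times I_{n+1}\times\cdots\times I_N$ with entries $[\mathcal{X}\times_n\mathbf{A}]_{i_1\cdots i_{n-1}ji_{n+1}\cdots i_N}=\sum_{i_n=1}^{I_n}x_{i_1\cdots i_N}a_{ji_n}$. Tucker decomposition: for $\mathcal{X}\in\mathbb{C}^{I_1\times\cdots\times I_N}$, $\mathcal{G}\in\mathbb{C}^{J_1\times\cdots\times J_N}$ (the core tensor) and $\mathbf{A}^{(n)}\in\mathbb{C}^{I_n\times J_n}$ (the factor matrices), the identity $\mathcal{X}=[\![\mathcal{G};\mathbf{A}^{(1)},\ldots,\mathbf{A}^{(N)}]\!]:=\mathcal{G}\times_1\mathbf{A}^{(1)}\times_2\cdots\times_N\mathbf{A}^{(N)}$ is called a Tucker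 decomposition of $\mathcal{X}$. It is independent if every factor matrix has full column rank. CP rank: $\mathrm{rank}_{CP}(\mathcal{X})$ is the minimum integer $r$ such that $\mathcal{X}=\sum_{t=1}^r\mathbf{a}^{(1,t)}\circ\cdots\circ\mathbf{a}^{(N,t)}$ for some vectors $\mathbf{a}^{(n,t)}\in\mathbb{C}^{I_n}$, where $\circ$ is the outer product, $[\mathbf{a}^{(1)}\circ\cdots\circ\mathbf{a}^{(N)}]_{i_1\cdots i_N}=a^{(1)}_{i_1}\cdots a^{(N)}_{i_N}$. *)

theory Defs
  imports Complex_Main "HOL-Library.FuncSet" "Jordan_Normal_Form.DL_Rank"
begin

text \<open>Tensors of arbitrary order, in the style of the matrices of \<open>Jordan_Normal_Form.Matrix\<close>: a
  tensor carries its list of dimensions. Entries are indexed by lists of naturals; indices and modes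
  are counted from 0.\<close>

definition indices :: "nat list \<Rightarrow> nat list set" where
  "indices ds = {is. length is = length ds \<and> (\<forall>n<length ds. is ! n < ds ! n)}"

typedef 'a tensor = "{(ds, f :: nat list \<Rightarrow> 'a). f \<in> extensional (indices ds)}"
  by (rule exI[of _ "([], restrict undefined (indices []))"]) simp

setup_lifting type_definition_tensor

lift_definition dims :: "'a tensor \<Rightarrow> nat list" is fst .

lift_definition entry :: "'a tensor \<Rightarrow> nat list \<Rightarrow> 'a" is snd .

lift_definition tensor :: "nat list \<Rightarrow> (nat list \<Rightarrow> 'a) \<Rightarrow> 'a tensor"
  is "\<lambda>ds f. (ds, restrict f (indices ds))" by simp

lemma dims_tensor [simp]: "dims (tensor ds f) = ds"
  by transfer simp

lemma entry_tensor [simp]: "is \<in> indices ds \<Longrightarrow> entry (tensor ds f) is = f is"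
  by transfer simp

lemma tensor_eqI:
  assumes "dims X = dims Y" and "\<And>is. is \<in> indices (dims X) \<Longrightarrow> entry X is = entry Y is"
  shows "X = Y"
  using assms by transfer (auto intro: extensionalityI)

definition mode_product :: "'a :: comm_semiring_1 tensor \<Rightarrow> nat \<Rightarrow> 'a mat \<Rightarrow> 'a tensor" where
  "mode_product X n A = tensor ((dims X)[n := dim_row A])
     (\<lambda>is. \<Sum>k<dims X ! n. entry X (is[n := k]) * A $$ (is ! n, k))"

definition tucker :: "'a :: comm_semiring_1 tensor \<Rightarrow> 'a mat list \<Rightarrow> 'a tensor" where
  "tucker G As = fold (\<lambda>n X. mode_product X n (As ! n)) [0..<length As] G"

definition tucker_decomposition ::
    "'a :: comm_semiring_1 tensor \<Rightarrow> 'a tensor \<Rightarrow> 'a mat list \<Rightarrow> bool" where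
  "tucker_decomposition X G As \<longleftrightarrow>
     length (dims G) = length (dims X) \<and> length As = length (dims X) \<and>
     (\<forall>n<length (dims X). As ! n \<in> carrier_mat (dims X ! n) (dims G ! n)) \<and>
     X = tucker G As"

definition full_column_rank :: "'a :: field mat \<Rightarrow> bool" where
  "full_column_rank A \<longleftrightarrow> vec_space.rank (dim_row A) A = dim_col A"

definition independent_tucker_decomposition ::
    "'a :: field tensor \<Rightarrow> 'a tensor \<Rightarrow> 'a mat list \<Rightarrow> bool" where
  "independent_tucker_decomposition X G As \<longleftrightarrow>
     tucker_decomposition X G As \<and> (\<forall>A\<in>set As. full_column_rank A)"

definition outer_product :: "'a :: comm_semiring_1 vec list \<Rightarrow> 'a tensor" where
  "outer_product as = tensor (map dim_vec as) (\<lambda>is. \<Prod>n<length as. as ! n $ (is ! n))"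

text \<open>The common size \<open>ds\<close> of the summands is an explicit argument, so that the empty sum is the zero
  tensor of that size.\<close>

definition tensor_sum ::
    "nat list \<Rightarrow> ('b \<Rightarrow> 'a :: comm_monoid_add tensor) \<Rightarrow> 'b set \<Rightarrow> 'a tensor" where
  "tensor_sum ds T S = tensor ds (\<lambda>is. \<Sum>t\<in>S. entry (T t) is)"

text \<open>The vector \<open>a t ! n\<close> is the mode-\<open>n\<close> factor of the \<open>t\<close>-th rank-one term. A decomposition exists
  for every tensor of order at least 1; for order 0 the minimum need not exist.\<close>

definition cp_rank :: "'a :: comm_semiring_1 tensor \<Rightarrow> nat" where
  "cp_rank X = (LEAST r. \<exists>a :: nat \<Rightarrow> 'a vec list.
     (\<forall>t<r. map dim_vec (a t) = dims X) \<and>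
     X = tensor_sum (dims X) (\<lambda>t. outer_product (a t)) {..<r})"

end

(* A matrix of full column rank has a left inverse, so multiplying one mode by such a matrix can be
   undone by another mode product. Since mode products map rank-one terms to rank-one terms, both
   tensors admit CP decompositions with exactly the same numbers of terms, one mode at a time. *)

theory Submission
  imports Defs "Jordan_Normal_Form.Gauss_Jordan_Elimination"
begin

section \<open>Left inverses from row reduction\<close>

text \<open>A non-zero kernel vector would be a linear dependence among the columns, while full rank
  makes them independent.\<close>

lemma full_column_rank_kernel:
  fixes A :: "'a :: field mat"
  assumes "full_column_rank A" and "v \<in> carrier_vec (dim_col A)"
    and "A *\<^sub>v v = 0\<^sub>v (dim_row A)"
  shows "v = 0\<^sub>v (dim_col A)"
proof -
  interpret vec_space "TYPE('a)" "dim_row A" .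
  have A: "A \<in> carrier_mat (dim_row A) (dim_col A)" by simp
  have rank: "rank A = dim_col A"
    using assms(1) by (simp add: full_column_rank_def)
  \<comment> \<open>Independence concerns the set of columns, which hides repetitions. The rank is
    the size of a maximal independent subset of it, so rank \<open>dim_col A\<close> forces the list
    \<open>cols A\<close> to be distinct.\<close>
  obtain S where S: "maximal S (\<lambda>T. T \<subseteq> set (cols A) \<and> lin_indpt T)"
    using maximal_exists[of "\<lambda>T. T \<subseteq> set (cols A) \<and> lin_indpt T" "card (set (cols A))" "{}"]
    by (meson List.finite_set card_mono empty_iff empty_subsetI finite_lin_indpt2 rev_finite_subset)
  have "dim_col A = card S"
    using rank_card_indpt[OF A S] rank by simp
  also have "\<dots> \<le> card (set (cols A))"
    using S by (simp add: maximal_def card_mono)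
  finally have "distinct (cols A)"
    by (metis card_distinct card_length cols_length le_antisym)
  then show ?thesis
    using lin_depI[OF A assms(2) _ assms(3)] full_rank_lin_indpt[OF A rank] by blast
qed

text \<open>Row reduction gives \<open>C = P * A\<close> in echelon form. A trivial kernel leaves no
  free column, so the pivot rows of \<open>C\<close> form an identity matrix; a matrix
  \<open>Q\<close> selecting them yields the left inverse \<open>Q * P\<close>.\<close>

lemma full_column_rank_left_inverse:
  fixes A :: "'a :: field mat"
  assumes "full_column_rank A"
  obtains B where "B \<in> carrier_mat (dim_col A) (dim_row A)" and "B * A = 1\<^sub>m (dim_col A)"
proof -
  define nr nc where "nr = dim_row A" and "nc = dim_col A"
  have A: "A \<in> carrier_mat nr nc" by (simp add: nr_def nc_def)
  \<comment> \<open>\<open>gauss_jordan\<close> reduces two matrices at once; the second is given no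
    columns.\<close>
  have Z: "0\<^sub>m nr 0 \<in> carrier_mat nr 0" by simp
  obtain C D where res: "gauss_jordan A (0\<^sub>m nr 0) = (C, D)" by fastforce
  have C: "C \<in> carrier_mat nr nc" using gauss_jordan_carrier[OF A Z res] by simp
  have re: "row_echelon_form C" using gauss_jordan_row_echelon[OF A res] .
  obtain P where P: "P \<in> carrier_mat nr nr" and CPA: "C = P * A"
    using gauss_jordan_transform[OF A Z res, of undefined]
    by (auto simp: Units_def ring_mat_def)
  obtain p where p: "pivot_fun C p nc" using re C by (auto simp: row_echelon_form_def)
  note piv = pivot_funD[OF carrier_matD(1)[OF C] p]
  have "snd ` set (pivot_positions C) = {0..<nc}"
  proof (rule ccontr)
    assume "snd ` set (pivot_positions C) \<noteq> {0..<nc}"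
    \<comment> \<open>A column without pivot yields a non-zero solution of the reduced system, and
      row operations preserve the kernel.\<close>
    from find_base_vector[OF re C this] obtain v
      where v: "v \<in> carrier_vec nc" "v \<noteq> 0\<^sub>v nc" "C *\<^sub>v v = 0\<^sub>v nr" by blast
    then have "A *\<^sub>v v = 0\<^sub>v nr" using gauss_jordan(1)[OF A Z res] by blast
    then show False
      using full_column_rank_kernel[OF assms] v unfolding nr_def nc_def by blast
  qed
  \<comment> \<open>The value \<open>p i = nc\<close> marks a zero row, so only rows with
    \<open>p i \<noteq> nc\<close> carry a pivot.\<close>
  then have "j \<in> snd ` {(i, p i) |i. i < nr \<and> p i \<noteq> nc}" if "j < nc" for j
    unfolding pivot_positions(1)[OF C p] using that by simp
  then have "\<forall>j<nc. \<exists>i<nr. p i = j" by force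
  then obtain r where r: "\<And>j. j < nc \<Longrightarrow> r j < nr \<and> p (r j) = j" by metis
  \<comment> \<open>Row \<open>r j\<close> of \<open>C\<close> has its pivot in column
    \<open>j\<close>, so row \<open>j\<close> of \<open>Q\<close> is the unit vector that picks it
    out.\<close>
  define Q :: "'a mat" where "Q = mat nc nr (\<lambda>(j, i). of_bool (i = r j))"
  have Q: "Q \<in> carrier_mat nc nr" by (simp add: Q_def)
  have "Q * C = 1\<^sub>m nc"
  proof (rule eq_matI)
    fix j k assume "j < dim_row (1\<^sub>m nc :: 'a mat)" "k < dim_col (1\<^sub>m nc :: 'a mat)"
    then have jk: "j < nc" "k < nc" by auto
    have "(Q * C) $$ (j, k) = (\<Sum>i<nr. of_bool (i = r j) * C $$ (i, k))"
      using jk C by (simp add: Q_def scalar_prod_def atLeast0LessThan)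
    also have "\<dots> = (\<Sum>i<nr. if i = r j then C $$ (i, k) else 0)"
      by (intro sum.cong) auto
    also have "\<dots> = C $$ (r j, k)"
      using r[OF jk(1)] by simp
    also have "\<dots> = (if j = k then 1 else 0)"
    proof (cases "j = k")
      case True
      then show ?thesis using piv(4)[of "r j"] r[OF jk(1)] jk by simp
    next
      case False
      \<comment> \<open>Column \<open>k\<close> is a pivot column: apart from the pivot in row
        \<open>r k\<close>, its entries vanish.\<close>
      then have "r j \<noteq> r k" using r jk by metis
      then show ?thesis
        using piv(5)[of "r k" "r j"] r[OF jk(1)] r[OF jk(2)] jk False by simp
    qed
    finally show "(Q * C) $$ (j, k) = 1\<^sub>m nc $$ (j, k)" using jk by simp
  qed (use Q C in auto)
  then have "Q * P * A = 1\<^sub>m nc" using Q P A CPA by (simp add: assoc_mult_mat)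
  moreover have "Q * P \<in> carrier_mat nc nr" using Q P by simp
  ultimately show thesis using that unfolding nr_def nc_def by blast
qed

section \<open>Mode products along a single mode\<close>

lemma indices_list_update:
  assumes "is \<in> indices (ds[n := m])" and "n < length ds" and "k < ds ! n"
  shows "is[n := k] \<in> indices ds"
proof -
  have "is[n := k] ! j < ds ! j" if "j < length ds" for j
    using assms that by (cases "j = n") (auto simp: indices_def dest: spec[of _ j])
  then show ?thesis using assms(1) by (simp add: indices_def)
qed

lemma indices_nth_less: "is \<in> indices ds \<Longrightarrow> n < length ds \<Longrightarrow> is ! n < ds ! n"
  by (simp add: indices_def)

lemma length_indices: "is \<in> indices ds \<Longrightarrow> length is = length ds"
  by (simp add: indices_def)

lemma dims_mode_product [simp]: "dims (mode_product X n A) = (dims X)[n := dim_row A]"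
  by (simp add: mode_product_def)

lemma entry_mode_product:
  "is \<in> indices ((dims X)[n := dim_row A]) \<Longrightarrow>
   entry (mode_product X n A) is = (\<Sum>k<dims X ! n. entry X (is[n := k]) * A $$ (is ! n, k))"
  by (simp add: mode_product_def)

lemma mode_product_one:
  assumes "n < length (dims X)"
  shows "mode_product X n (1\<^sub>m (dims X ! n)) = X"
proof (rule tensor_eqI)
  fix "is" assume "is \<in> indices (dims (mode_product X n (1\<^sub>m (dims X ! n))))"
  then have i: "is \<in> indices (dims X)" by simp
  note n = indices_nth_less[OF i assms]
  have "entry (mode_product X n (1\<^sub>m (dims X ! n))) is
      = (\<Sum>k<dims X ! n. entry X (is[n := k]) * 1\<^sub>m (dims X ! n) $$ (is ! n, k))"
    using i by (simp add: entry_mode_product)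
  also have "\<dots> = (\<Sum>k<dims X ! n. if is ! n = k then entry X (is[n := k]) else 0)"
    using n by (intro sum.cong) auto
  also have "\<dots> = entry X is" using n by simp
  finally show "entry (mode_product X n (1\<^sub>m (dims X ! n))) is = entry X is" .
qed simp

text \<open>Exchanging the two finite sums turns the inner one into an entry of
  \<open>B * A\<close>. With \<open>B\<close> a left inverse of \<open>A\<close>, the second product
  undoes the first.\<close>

lemma mode_product_mode_product:
  assumes n: "n < length (dims X)" and A: "dim_col A = dims X ! n" and B: "dim_col B = dim_row A"
  shows "mode_product (mode_product X n A) n B = mode_product X n (B * A)"
proof (rule tensor_eqI)
  fix "is" assume "is \<in> indices (dims (mode_product (mode_product X n A) n B))"
  then have i: "is \<in> indices ((dims X)[n := dim_row B])" by simp
  have isn: "is ! n < dim_row B" using indices_nth_less[OF i, of n] n by simp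
  have upd: "is[n := k] \<in> indices ((dims X)[n := dim_row A])" if "k < dim_row A" for k
    using indices_list_update[of "is" "(dims X)[n := dim_row A]" n "dim_row B" k] i n that by simp
  have len: "n < length is" using length_indices[OF i] n by simp
  have "entry (mode_product (mode_product X n A) n B) is
      = (\<Sum>k<dim_row A. entry (mode_product X n A) (is[n := k]) * B $$ (is ! n, k))"
    using i n by (simp add: entry_mode_product)
  also have "\<dots> = (\<Sum>k<dim_row A. (\<Sum>l<dims X ! n. entry X (is[n := l]) * A $$ (k, l))
      * B $$ (is ! n, k))"
    using upd len by (intro sum.cong) (simp_all add: entry_mode_product)
  also have "\<dots> = (\<Sum>k<dim_row A. \<Sum>l<dims X ! n.
      entry X (is[n := l]) * (B $$ (is ! n, k) * A $$ (k, l)))"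
    by (simp add: sum_distrib_left sum_distrib_right mult_ac)
  also have "\<dots> = (\<Sum>l<dims X ! n. \<Sum>k<dim_row A.
      entry X (is[n := l]) * (B $$ (is ! n, k) * A $$ (k, l)))"
    by (rule sum.swap)
  also have "\<dots> = (\<Sum>l<dims X ! n. entry X (is[n := l]) * (B * A) $$ (is ! n, l))"
    using isn A B
    by (intro sum.cong) (simp_all add: scalar_prod_def sum_distrib_left atLeast0LessThan)
  also have "\<dots> = entry (mode_product X n (B * A)) is"
    using i by (simp add: entry_mode_product)
  finally show "entry (mode_product (mode_product X n A) n B) is
    = entry (mode_product X n (B * A)) is" .
qed simp

section \<open>Mode products of sums and of rank-one terms\<close>

lemma dims_tensor_sum [simp]: "dims (tensor_sum ds T S) = ds"
  by (simp add: tensor_sum_def)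

lemma entry_tensor_sum:
  "is \<in> indices ds \<Longrightarrow> entry (tensor_sum ds T S) is = (\<Sum>t\<in>S. entry (T t) is)"
  by (simp add: tensor_sum_def)

text \<open>Linearity of the mode product. Each summand must have size \<open>ds\<close>, because
  \<open>mode_product\<close> takes its summation range from the summand's own dimensions.\<close>

lemma mode_product_tensor_sum:
  assumes "n < length ds" and "\<And>t. t \<in> S \<Longrightarrow> dims (T t) = ds"
  shows "mode_product (tensor_sum ds T S) n A
    = tensor_sum (ds[n := dim_row A]) (\<lambda>t. mode_product (T t) n A) S"
proof (rule tensor_eqI)
  fix "is" assume "is \<in> indices (dims (mode_product (tensor_sum ds T S) n A))"
  then have i: "is \<in> indices (ds[n := dim_row A])" by simp
  have "entry (mode_product (tensor_sum ds T S) n A) is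
      = (\<Sum>k<ds ! n. (\<Sum>t\<in>S. entry (T t) (is[n := k])) * A $$ (is ! n, k))"
    using i indices_list_update[OF i assms(1)]
    by (simp add: entry_mode_product entry_tensor_sum)
  also have "\<dots> = (\<Sum>t\<in>S. \<Sum>k<ds ! n. entry (T t) (is[n := k]) * A $$ (is ! n, k))"
    unfolding sum_distrib_right by (rule sum.swap)
  also have "\<dots> = (\<Sum>t\<in>S. entry (mode_product (T t) n A) is)"
    using i assms(2) by (intro sum.cong) (simp_all add: entry_mode_product)
  also have "\<dots> = entry (tensor_sum (ds[n := dim_row A]) (\<lambda>t. mode_product (T t) n A) S) is"
    using i by (simp add: entry_tensor_sum)
  finally show "entry (mode_product (tensor_sum ds T S) n A) is
    = entry (tensor_sum (ds[n := dim_row A]) (\<lambda>t. mode_product (T t) n A) S) is" .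
qed simp

lemma dims_outer_product [simp]: "dims (outer_product as) = map dim_vec as"
  by (simp add: outer_product_def)

lemma entry_outer_product:
  "is \<in> indices (map dim_vec as) \<Longrightarrow>
   entry (outer_product as) is = (\<Prod>m<length as. as ! m $ (is ! m))"
  by (simp add: outer_product_def)

text \<open>Only the factor in mode \<open>n\<close> depends on the summation index; the others come
  out of the sum, which becomes a matrix-vector product.\<close>

lemma mode_product_outer_product:
  assumes n: "n < length as" and A: "dim_col A = dim_vec (as ! n)"
  shows "mode_product (outer_product as) n A = outer_product (as[n := A *\<^sub>v as ! n])"
proof (rule tensor_eqI)
  fix "is" assume "is \<in> indices (dims (mode_product (outer_product as) n A))"
  then have i: "is \<in> indices ((map dim_vec as)[n := dim_row A])" by simp
  have isn: "is ! n < dim_row A" using indices_nth_less[OF i, of n] n by simp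
  have len: "n < length is" using length_indices[OF i] n by simp
  \<comment> \<open>The product over the modes other than \<open>n\<close>, unchanged when position
    \<open>n\<close> of the index is updated.\<close>
  define q where "q = (\<Prod>m\<in>{..<length as} - {n}. as ! m $ (is ! m))"
  have split: "(\<Prod>m<length as. f m) = f n * (\<Prod>m\<in>{..<length as} - {n}. f m)"
    for f :: "nat \<Rightarrow> 'a"
    using n by (simp add: prod.remove)
  have entry: "entry (outer_product as) (is[n := k]) = as ! n $ k * q"
    if "k < dim_vec (as ! n)" for k
  proof -
    have "is[n := k] \<in> indices (map dim_vec as)"
      using indices_list_update[OF i] n that by simp
    then show ?thesis
      using len by (simp add: entry_outer_product split q_def)
  qed
  have "entry (mode_product (outer_product as) n A) is
      = (\<Sum>k<dim_vec (as ! n). as ! n $ k * q * A $$ (is ! n, k))"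
    using i n entry by (simp add: entry_mode_product)
  also have "\<dots> = (A *\<^sub>v as ! n) $ (is ! n) * q"
    using isn A by (simp add: scalar_prod_def sum_distrib_left sum_distrib_right atLeast0LessThan mult_ac)
  also have "\<dots> = entry (outer_product (as[n := A *\<^sub>v as ! n])) is"
    using i n by (simp add: entry_outer_product map_update split q_def)
  finally show "entry (mode_product (outer_product as) n A) is
    = entry (outer_product (as[n := A *\<^sub>v as ! n])) is" .
qed (simp add: map_update)

section \<open>CP rank under mode products\<close>

text \<open>Isolates the predicate minimised by \<open>cp_rank\<close>: tensors that satisfy it for
  the same \<open>r\<close> have equal CP rank.\<close>

definition cp_decomposable :: "nat \<Rightarrow> 'a :: comm_semiring_1 tensor \<Rightarrow> bool" where
  "cp_decomposable r X \<longleftrightarrow> (\<exists>a :: nat \<Rightarrow> 'a vec list.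
     (\<forall>t<r. map dim_vec (a t) = dims X) \<and>
     X = tensor_sum (dims X) (\<lambda>t. outer_product (a t)) {..<r})"

lemma cp_rank_eq_Least: "cp_rank X = (LEAST r. cp_decomposable r X)"
  by (simp add: cp_rank_def cp_decomposable_def)

text \<open>Applying \<open>A\<close> to the factor of mode \<open>n\<close> in each term keeps the
  number of terms. As \<open>A\<close> is any matrix of matching size, this serves for a left
  inverse too.\<close>

lemma cp_decomposable_mode_product:
  assumes "cp_decomposable r X" and n: "n < length (dims X)" and A: "dim_col A = dims X ! n"
  shows "cp_decomposable r (mode_product X n A)"
proof -
  obtain a where a: "\<And>t. t < r \<Longrightarrow> map dim_vec (a t) = dims X"
    and X: "X = tensor_sum (dims X) (\<lambda>t. outer_product (a t)) {..<r}"
    using assms(1) by (auto simp: cp_decomposable_def)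
  define b where "b t = (a t)[n := A *\<^sub>v a t ! n]" for t
  have len: "length (a t) = length (dims X)" if "t < r" for t
    using a[OF that] by (metis length_map)
  have dim: "dim_vec (a t ! n) = dims X ! n" if "t < r" for t
    using a[OF that] len[OF that] n by (metis nth_map)
  have "mode_product X n A
      = tensor_sum ((dims X)[n := dim_row A]) (\<lambda>t. mode_product (outer_product (a t)) n A) {..<r}"
    using mode_product_tensor_sum[OF n, of "{..<r}" "\<lambda>t. outer_product (a t)" A] a X by simp
  also have "\<dots> = tensor_sum ((dims X)[n := dim_row A]) (\<lambda>t. outer_product (b t)) {..<r}"
    \<comment> \<open>The factor lists are known to have the right sizes only for
      \<open>t < r\<close>, so the summands are compared under the sum.\<close>
    unfolding tensor_sum_def b_def
    using n A len dim
    by (intro arg_cong[where f = "tensor _"] ext sum.cong) (simp_all add: mode_product_outer_product)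
  finally show ?thesis
    unfolding cp_decomposable_def using a by (auto simp: b_def map_update intro!: exI[of _ b])
qed

lemma cp_rank_mode_product:
  fixes X :: "'a :: field tensor"
  assumes n: "n < length (dims X)" and A: "dim_col A = dims X ! n" and "full_column_rank A"
  shows "cp_rank (mode_product X n A) = cp_rank X"
proof -
  obtain B where B: "B \<in> carrier_mat (dim_col A) (dim_row A)" "B * A = 1\<^sub>m (dim_col A)"
    using full_column_rank_left_inverse[OF assms(3)] .
  have "mode_product (mode_product X n A) n B = X"
    using mode_product_mode_product[OF n A, of B] B A mode_product_one[OF n] by simp
  \<comment> \<open>Multiplying by \<open>B\<close> transports a decomposition of the product back
    to \<open>X\<close>.\<close>
  then have "cp_decomposable r X" if "cp_decomposable r (mode_product X n A)" for r
    using cp_decomposable_mode_product[OF that, of n B] n B(1) by simp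
  then have "cp_decomposable r (mode_product X n A) \<longleftrightarrow> cp_decomposable r X" for r
    using cp_decomposable_mode_product[OF _ n A] by blast
  then show ?thesis by (simp add: cp_rank_eq_Least)
qed

text \<open>The factor matrices are applied one mode at a time, and no single step changes the
  rank.\<close>

lemma cp_rank_tucker:
  fixes G :: "'a :: field tensor"
  assumes len: "length As = length (dims G)"
    and cols: "\<And>n. n < length As \<Longrightarrow> dim_col (As ! n) = dims G ! n"
    and rank: "\<And>n. n < length As \<Longrightarrow> full_column_rank (As ! n)"
  shows "cp_rank (tucker G As) = cp_rank G"
proof -
  let ?T = "\<lambda>m. fold (\<lambda>n X. mode_product X n (As ! n)) [0..<m] G"
  \<comment> \<open>The clause for \<open>n \<ge> m\<close> says that modes not yet processed keep
    their size from \<open>G\<close>, so the next factor matrix fits.\<close>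
  have "cp_rank (?T m) = cp_rank G \<and> length (dims (?T m)) = length (dims G) \<and>
    (\<forall>n\<ge>m. dims (?T m) ! n = dims G ! n)" if "m \<le> length As" for m
    using that by (induction m) (auto simp: cp_rank_mode_product len cols rank)
  then show ?thesis by (simp add: tucker_def)
qed

theorem theorem2:
  fixes N :: nat and I J :: "nat list"
    and X G :: "complex tensor" and A :: "complex mat list"
  assumes "N \<ge> 1"
    and "length I = N" and "length J = N" and "length A = N"
    and "dims X = I" and "dims G = J"
    and "\<And>n. n < N \<Longrightarrow> A ! n \<in> carrier_mat (I ! n) (J ! n)"
    and "independent_tucker_decomposition X G A"
  shows "cp_rank X = cp_rank G"
proof -
  have X: "X = tucker G A" and rank: "\<And>n. n < N \<Longrightarrow> full_column_rank (A ! n)"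
    using assms(4,8)
    by (auto simp: independent_tucker_decomposition_def tucker_decomposition_def)
  show ?thesis
    unfolding X using assms(3,4,6,7) rank by (intro cp_rank_tucker) auto
qed

end
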